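(* Let $m$ be a positive integer and let $S$ be a numerical semigroup with multiplicity $m$. Then $S$ is $m$-irreducible if and only if one of the following conditions holds: (1) $S = \{x \in \mathbb{N} : x \ge m\} \cup \{0\}$; (2) $S = \{x \in \mathbb{N} : x \ge m,\ x \ne f\} \cup \{0\}$ for some $f \in \{m+1, \ldots, 2m-1\}$; (3) $S$ is an irreducible numerical semigroup.
   Context: $\mathbb{N}$ denotes the set of nonnegative integers. A numerical semigroup is a subset $S \subseteq \mathbb{N}$ closed under addition, containing $0$, and such that $\mathbb{N}\setminus S$ is finite. A numerical semigroup is irreducible if it cannot be expressed as an intersection of two numerical semigroups each containing it properly. The multiplicity of $S$ is the least positive integer belonging to $S$. For a positive integer $m$, $\mathcal{S}(m)$ denotes the set of numerical semigroups with multiplicity $m$. An element $S \in \mathcal{S}(m)$ is $m$-irreducible if it cannot be expressed as the intersection of two elements of $\mathcal{S}(m)$ each containing $S$ properly. *)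

theory Defs
  imports Main
begin

definition numerical_semigroup :: "nat set \<Rightarrow> bool" where
  "numerical_semigroup S \<longleftrightarrow>
     0 \<in> S \<and> (\<forall>x\<in>S. \<forall>y\<in>S. x + y \<in> S) \<and> finite (UNIV - S)"

definition irreducible_numerical_semigroup :: "nat set \<Rightarrow> bool" where
  "irreducible_numerical_semigroup S \<longleftrightarrow>
     numerical_semigroup S \<and>
     \<not> (\<exists>T U. numerical_semigroup T \<and> numerical_semigroup U \<and>
            S \<subset> T \<and> S \<subset> U \<and> S = T \<inter> U)"

text \<open>The least element below exists for every numerical semigroup, since a cofinite
  subset of the naturals contains positive elements.\<close>

definition multiplicity :: "nat set \<Rightarrow> nat" where
  "multiplicity S = (LEAST x. 0 < x \<and> x \<in> S)"

definition semigroups_of_multiplicity :: "nat \<Rightarrow> nat set set" where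
  "semigroups_of_multiplicity m = {S. numerical_semigroup S \<and> multiplicity S = m}"

definition m_irreducible :: "nat \<Rightarrow> nat set \<Rightarrow> bool" where
  "m_irreducible m S \<longleftrightarrow>
     S \<in> semigroups_of_multiplicity m \<and>
     \<not> (\<exists>T\<in>semigroups_of_multiplicity m. \<exists>U\<in>semigroups_of_multiplicity m.
            S \<subset> T \<and> S \<subset> U \<and> S = T \<inter> U)"

end

(*
  Let F be the Frobenius number of S. If S differs from {0, m, m+1, ...}, then F > m, so adjoining F
  to S yields a semigroup of multiplicity m; hence an m-irreducible S is maximal among the
  semigroups of multiplicity m avoiding F. If every gap x other than F/2 has F - x in S, then every
  proper oversemigroup of S contains F and S is irreducible. Otherwise the largest gap h with
  F - h a gap and 2h \<noteq> F can be adjoined to S. Maximality forces h < m, so F < 2h < 2m and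
  F is the only gap exceeding m.
*)

theory Submission
  imports Defs
begin

lemma numerical_semigroup_add:
  "numerical_semigroup S \<Longrightarrow> x \<in> S \<Longrightarrow> y \<in> S \<Longrightarrow> x + y \<in> S"
  by (simp add: numerical_semigroup_def)

lemma numerical_semigroup_zero: "numerical_semigroup S \<Longrightarrow> 0 \<in> S"
  by (simp add: numerical_semigroup_def)

text \<open>The case \<open>s = 0\<close> is left out because \<open>h + 0\<close> is
  \<open>h\<close> itself, typically a gap of \<open>S\<close>.\<close>

lemma numerical_semigroup_insert:
  assumes "numerical_semigroup S" "h + h \<in> S" "\<And>s. s \<in> S \<Longrightarrow> 0 < s \<Longrightarrow> h + s \<in> S"
  shows "numerical_semigroup (insert h S)"
proof -
  have "h + s \<in> insert h S" "s + h \<in> insert h S" if "s \<in> S" for s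
    using assms(3)[OF that] by (cases "s = 0"; simp add: add.commute)+
  moreover have "finite (UNIV - insert h S)"
    using assms(1) unfolding numerical_semigroup_def by (auto intro: finite_subset[rotated])
  ultimately show ?thesis
    using assms(1,2) unfolding numerical_semigroup_def by auto
qed

lemma multiplicity_eq_iff:
  assumes "numerical_semigroup S"
  shows "multiplicity S = m \<longleftrightarrow> 0 < m \<and> m \<in> S \<and> (\<forall>x\<in>S. 0 < x \<longrightarrow> m \<le> x)"
proof -
  have "\<exists>x. 0 < x \<and> x \<in> S"
  proof (rule ccontr)
    assume "\<not> ?thesis"
    then have "{0<..} \<subseteq> UNIV - S" by (metis DiffI UNIV_I greaterThan_iff subsetI)
    then show False
      using assms infinite_Ioi finite_subset unfolding numerical_semigroup_def by blast
  qed
  then have "0 < multiplicity S \<and> multiplicity S \<in> S"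
    unfolding multiplicity_def by (rule LeastI_ex)
  moreover have "multiplicity S \<le> x" if "x \<in> S" "0 < x" for x
    unfolding multiplicity_def using that by (simp add: Least_le)
  ultimately show ?thesis by (metis order_antisym)
qed

lemma semigroups_of_multiplicity_iff:
  "S \<in> semigroups_of_multiplicity m \<longleftrightarrow>
     numerical_semigroup S \<and> 0 < m \<and> m \<in> S \<and> (\<forall>x\<in>S. 0 < x \<longrightarrow> m \<le> x)"
  unfolding semigroups_of_multiplicity_def using multiplicity_eq_iff by blast

lemma Frobenius_number_exists:
  assumes "numerical_semigroup S" "S \<noteq> UNIV"
  obtains F where "F \<notin> S" "\<And>x. F < x \<Longrightarrow> x \<in> S"
proof
  have fin: "finite (UNIV - S)" and ne: "UNIV - S \<noteq> {}"
    using assms by (auto simp: numerical_semigroup_def)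
  show "Max (UNIV - S) \<notin> S" using Max_in[OF fin ne] by simp
  show "x \<in> S" if "Max (UNIV - S) < x" for x
    using Max_ge[OF fin, of x] that by fastforce
qed

text \<open>Every sum of \<open>F\<close> with a positive number exceeds \<open>F\<close>, so
  \<open>insert F S\<close> is closed under addition, and \<open>m < F\<close> preserves the
  multiplicity. If \<open>T\<close> missed \<open>F\<close>, then \<open>T\<close> and
  \<open>insert F S\<close> would decompose \<open>S\<close>.\<close>

lemma m_irreducible_proper_superset_Frobenius:
  assumes irr: "m_irreducible m S" and F: "F \<notin> S" "\<And>x. F < x \<Longrightarrow> x \<in> S" "m < F"
    and T: "T \<in> semigroups_of_multiplicity m" "S \<subset> T"
  shows "F \<in> T"
proof (rule ccontr)
  assume "F \<notin> T"
  have S: "S \<in> semigroups_of_multiplicity m"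
    using irr by (simp add: m_irreducible_def)
  have "numerical_semigroup (insert F S)"
    using S F by (intro numerical_semigroup_insert) (auto simp: semigroups_of_multiplicity_iff)
  then have "insert F S \<in> semigroups_of_multiplicity m"
    using S F(3) by (auto simp: semigroups_of_multiplicity_iff)
  moreover have "S \<subset> insert F S" "S = insert F S \<inter> T"
    using F(1) T(2) \<open>F \<notin> T\<close> by auto
  ultimately show False
    using irr T unfolding m_irreducible_def by blast
qed

text \<open>A gap \<open>x\<close> of \<open>S\<close> lying in \<open>T\<close> produces
  \<open>F\<close> in \<open>T\<close>, either as \<open>x + (F - x)\<close> or as
  \<open>x + x\<close>. Hence two proper oversemigroups always share the gap
  \<open>F\<close>.\<close>

lemma irreducible_if_symmetric_gaps:
  assumes S: "numerical_semigroup S" and F: "F \<notin> S" "\<And>x. F < x \<Longrightarrow> x \<in> S"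
    and sym: "\<And>x. x \<notin> S \<Longrightarrow> F - x \<in> S \<or> 2 * x = F"
  shows "irreducible_numerical_semigroup S"
proof -
  have "F \<in> T" if T: "numerical_semigroup T" "S \<subset> T" for T
  proof -
    obtain x where x: "x \<in> T" "x \<notin> S" using T(2) by auto
    then have "x \<le> F" using F(2) not_le by blast
    from sym[OF x(2)] show ?thesis
    proof
      assume "F - x \<in> S"
      then have "x + (F - x) \<in> T" using T x(1) by (blast intro: numerical_semigroup_add)
      then show ?thesis using \<open>x \<le> F\<close> by simp
    next
      assume "2 * x = F"
      then show ?thesis using numerical_semigroup_add[OF T(1) x(1) x(1)] by (simp add: mult_2)
    qed
  qed
  then show ?thesis
    using S F(1) unfolding irreducible_numerical_semigroup_def by blast
qed

lemma insert_largest_asymmetric_gap: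
  assumes S: "numerical_semigroup S" and F: "F \<notin> S" "\<And>x. F < x \<Longrightarrow> x \<in> S"
    and x: "x \<notin> S" "F - x \<notin> S" "2 * x \<noteq> F"
  obtains h where "h \<notin> S" "h < F" "F < 2 * h" "\<And>y. h < y \<Longrightarrow> y \<notin> S \<Longrightarrow> F - y \<in> S"
    "numerical_semigroup (insert h S)"
proof -
  define B where "B = {y. y \<notin> S \<and> F - y \<notin> S \<and> 2 * y \<noteq> F}"
  have less: "y < F" if "y \<in> B" for y
    \<comment> \<open>Truncated subtraction makes \<open>F - y\<close> equal to 0, an element of
      \<open>S\<close>, as soon as \<open>F \<le> y\<close>.\<close>
    using that F(2)[of y] numerical_semigroup_zero[OF S] unfolding B_def
    by (metis (mono_tags, lifting) diff_is_0_eq mem_Collect_eq not_le)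
  then have fin: "finite B" by (metis finite_nat_set_iff_bounded)
  have ne: "B \<noteq> {}" using x by (auto simp: B_def)
  define h where "h = Max B"
  have hB: "h \<in> B" unfolding h_def using Max_in[OF fin ne] .
  have max: "y \<le> h" if "y \<in> B" for y unfolding h_def using fin that by simp
  \<comment> \<open>\<open>B\<close> is stable under the reflection of \<open>y\<close> to
    \<open>F - y\<close>, so its maximum lies in the upper half; the midpoint is excluded by the
    definition of \<open>B\<close>.\<close>
  have "F - h \<in> B" using hB less[OF hB] by (auto simp: B_def)
  with max have "F - h \<le> h" by blast
  with hB have h2: "F < 2 * h" by (auto simp: B_def)
  have above: "F - y \<in> S" if "h < y" "y \<notin> S" for y
    using max[of y] that h2 by (auto simp: B_def)
  have "h + s \<in> S" if "s \<in> S" "0 < s" for s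
  proof (rule ccontr)
    assume gap: "h + s \<notin> S"
    then have "h + s \<le> F" using F(2) not_le by blast
    \<comment> \<open>This sum equals \<open>F - h\<close>, which is a gap because \<open>h\<close>
      is in \<open>B\<close>.\<close>
    moreover have "(F - (h + s)) + s \<in> S"
      using above[OF _ gap] that S by (auto intro: numerical_semigroup_add)
    ultimately show False using hB by (simp add: B_def)
  qed
  then have "numerical_semigroup (insert h S)"
    using S F(2) h2 by (intro numerical_semigroup_insert) (auto simp: mult_2)
  then show thesis using that[of h] hB less[OF hB] h2 above by (auto simp: B_def)
qed

lemma m_irreducible_cases:
  assumes irr: "m_irreducible m S" and ne: "S \<noteq> {x. m \<le> x} \<union> {0}"
    and nirr: "\<not> irreducible_numerical_semigroup S"
  shows "\<exists>f\<in>{m + 1..2 * m - 1}. S = {x. m \<le> x \<and> x \<noteq> f} \<union> {0}"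
proof -
  have Sm: "S \<in> semigroups_of_multiplicity m"
    using irr by (simp add: m_irreducible_def)
  then have S: "numerical_semigroup S" and m: "0 < m" "m \<in> S"
    and min: "\<And>x. x \<in> S \<Longrightarrow> 0 < x \<Longrightarrow> m \<le> x"
    by (auto simp: semigroups_of_multiplicity_iff)
  obtain g where g: "m \<le> g" "g \<notin> S"
    using ne min numerical_semigroup_zero[OF S] by fastforce
  then obtain F where F: "F \<notin> S" "\<And>x. F < x \<Longrightarrow> x \<in> S"
    using Frobenius_number_exists[OF S] by blast
  have "m < F" using F g m(2) by (metis le_neq_implies_less not_le order_trans)
  obtain x where "x \<notin> S" "F - x \<notin> S" "2 * x \<noteq> F"
    using irreducible_if_symmetric_gaps[OF S F] nirr by blast
  then obtain h where h: "h \<notin> S" "h < F" "F < 2 * h"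
      "\<And>y. h < y \<Longrightarrow> y \<notin> S \<Longrightarrow> F - y \<in> S" "numerical_semigroup (insert h S)"
    using insert_largest_asymmetric_gap[OF S F] by blast
  \<comment> \<open>Otherwise \<open>insert h S\<close> would be a proper oversemigroup of
    multiplicity \<open>m\<close> that misses \<open>F\<close>.\<close>
  have "h < m"
  proof (rule ccontr)
    assume "\<not> h < m"
    then have "insert h S \<in> semigroups_of_multiplicity m"
      using h(5) m min by (auto simp: semigroups_of_multiplicity_iff)
    then have "F \<in> insert h S"
      using m_irreducible_proper_superset_Frobenius[OF irr F \<open>m < F\<close>] h(1) by blast
    with F(1) h(2) show False by simp
  qed
  have only: "y = F" if "m \<le> y" "y \<notin> S" for y
  proof -
    have "F - y \<in> S" using h(4) that \<open>h < m\<close> by simp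
    \<comment> \<open>Indeed \<open>F < 2 * h < 2 * m\<close> and \<open>m \<le> y\<close>; the only
      element of \<open>S\<close> below \<open>m\<close> is 0.\<close>
    moreover have "F - y < m" using h(3) that(1) \<open>h < m\<close> by linarith
    ultimately have "F - y = 0" using min by (meson not_gr0 not_le)
    moreover have "y \<le> F" using F(2) that(2) not_le by blast
    ultimately show ?thesis by simp
  qed
  have "S = {x. m \<le> x \<and> x \<noteq> F} \<union> {0}"
    using only min F(1) numerical_semigroup_zero[OF S] by auto
  moreover have "F \<in> {m + 1..2 * m - 1}"
    using \<open>m < F\<close> h(3) \<open>h < m\<close> by auto
  ultimately show ?thesis by blast
qed

text \<open>A decomposition inside multiplicity \<open>m\<close> is in particular one into numerical
  semigroups.\<close>

lemma m_irreducible_if_irreducible: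
  assumes "S \<in> semigroups_of_multiplicity m" "irreducible_numerical_semigroup S"
  shows "m_irreducible m S"
  using assms
  unfolding m_irreducible_def irreducible_numerical_semigroup_def semigroups_of_multiplicity_def
  by blast

text \<open>Assuming an inclusion rather than an equality covers both explicit families at once. At
  most \<open>f\<close> can be added to \<open>S\<close> without changing the multiplicity, so any
  two proper oversemigroups share \<open>f\<close>.\<close>

lemma m_irreducible_if_almost_maximal:
  assumes "S \<in> semigroups_of_multiplicity m" "{x. m \<le> x \<and> x \<noteq> f} \<union> {0} \<subseteq> S"
  shows "m_irreducible m S"
proof -
  have "f \<in> T" if T: "T \<in> semigroups_of_multiplicity m" "S \<subset> T" for T
  proof -
    obtain x where x: "x \<in> T" "x \<notin> S" using T(2) by auto
    then have "0 < x" using assms(2) by (cases x) auto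
    then have "m \<le> x" using T(1) x(1) by (auto simp: semigroups_of_multiplicity_iff)
    with x assms(2) show ?thesis by auto
  qed
  moreover have "f \<notin> S" if "T \<in> semigroups_of_multiplicity m" "S \<subset> T" for T
  proof
    assume "f \<in> S"
    \<comment> \<open>Now \<open>S\<close> is the largest semigroup of multiplicity
      \<open>m\<close>, so no proper \<open>T\<close> exists.\<close>
    then have "{x. m \<le> x} \<union> {0} \<subseteq> S" using assms(2) by auto
    moreover have "T \<subseteq> {x. m \<le> x} \<union> {0}"
      using that(1) by (auto simp: semigroups_of_multiplicity_iff)
    ultimately show False using that(2) by blast
  qed
  ultimately show ?thesis
    using assms(1) unfolding m_irreducible_def by blast
qed

theorem corollary7:
  fixes m :: nat and S :: "nat set"
  assumes "0 < m"
    and "numerical_semigroup S"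
    and "multiplicity S = m"
  shows "m_irreducible m S \<longleftrightarrow>
           S = {x. m \<le> x} \<union> {0} \<or>
           (\<exists>f\<in>{m + 1..2 * m - 1}. S = {x. m \<le> x \<and> x \<noteq> f} \<union> {0}) \<or>
           irreducible_numerical_semigroup S"
proof -
  have S: "S \<in> semigroups_of_multiplicity m"
    using assms by (simp add: semigroups_of_multiplicity_def)
  have "m_irreducible m S" if "S = {x. m \<le> x} \<union> {0}"
    \<comment> \<open>The choice of 0 is arbitrary: nothing from \<open>m\<close> on is missing from
      \<open>S\<close>.\<close>
    using m_irreducible_if_almost_maximal[OF S, of 0] that by auto
  moreover have "m_irreducible m S" if "S = {x. m \<le> x \<and> x \<noteq> f} \<union> {0}" for f
    using m_irreducible_if_almost_maximal[OF S, of f] that by simp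
  ultimately show ?thesis
    using m_irreducible_cases m_irreducible_if_irreducible[OF S] by blast
qed

end
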